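(* Let $X$ be a countably infinite discrete set, $m:X\to(0,\infty)$, $b$ a connected symmetric weighted graph over $X$, $c:X\to\mathbb{R}$, and let $Q=Q_{b,c}$ be a regular Dirichlet form on $\ell^2(X,m)$ with associated self-adjoint operator $H$. Suppose that there is a bounded function $W:X\to\mathbb{R}$ such that $H+W$ is critical in $X$ with ground state $\varphi$. If $u\in F(X)$ is a generalized eigenfunction of $H$ with eigenvalue $\lambda\in\mathbb{R}$ and $|u|\le\varphi$ in $X$, then $\lambda\in\sigma(H)$.
   Context: A symmetric weighted graph over $X$ is a map $b:X\times X\to[0,\infty)$ with $b(x,x)=0$, $b(x,y)=b(y,x)$ and $\sum_{y\in X}b(x,y)<\infty$ for all $x,y\in X$; vertices $x,y$ are adjacent if $b(x,y)>0$, and $b$ is connected if every two vertices are joined by a path of adjacent vertices. Functions are real-valued; $\ell^2(X,m)$ consists of all $u:X\to\mathbb{R}$ with $\sum_xu(x)^2m(x)<\infty$, with inner product $\langle u,v\rangle=\sum_xu(x)v(x)m(x)$ and norm $\|\cdot\|$. $C_0(X)$ is the set of finitely supported functions. $$Q_{b,c}(u,v)=\sum_{x,y\in X}b(x,y)(u(x)-u(y))(v(x)-v(y))+\sum_{x\in X}c(x)u(x)v(x)$$ (first sum over all ordered pairs), with domain the closure of $C_0(X)$ in the norm $(Q_{b,c}(v,v)+\|v\|^2)^{1/2}$; $H$ is the associated self-adjoint operator in $\ell^2(X,m)$ and $\sigma(H)$ its spectrum. For bounded $W$, the form of $H+W$ is $Q_{H+W}(u,v)=Q_{b,c}(u,v)+\sum_xW(x)u(x)v(x)m(x)$.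 If $Q_{H+W}(v,v)\ge0$ for all $v\in C_0(X)$, then $H+W$ is subcritical in $X$ if there is a nonzero $W':X\to[0,\infty)$ such that $Q_{H+W}(v,v)-\sum_xW'(x)v(x)^2\ge0$ for all $v\in C_0(X)$, and critical otherwise (criticality thus includes nonnegativity on $C_0(X)$). $F(X)$ is the set of all $u:X\to\mathbb{R}$ with $\sum_{y}b(x,y)|u(y)|<\infty$ for each $x\in X$. If $H+W$ is critical (and $b$ connected), there is, up to a positive multiplicative constant, a unique positive $\varphi\in F(X)$ that is $(H+W)$-harmonic, i.e. $Q_{H+W}(\varphi,v)=0$ for all $v\in C_0(X)$; it is called the ground state of $H+W$. A nonzero $u\in F(X)$ is a generalized eigenfunction of $H$ with eigenvalue $\lambda$ if $Q_{b,c}(u,v)=\lambda\langle u,v\rangle$ for all $v\in C_0(X)$. *)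

theory Defs
  imports "HOL-Analysis.Analysis"
begin

text \<open>
  The discrete space is the universe of the type \<open>'a\<close>. As \<open>m > 0\<close> everywhere, elements
  of \<open>\<ell>\<^sup>2(X,m)\<close> are functions, with no quotient by null sets. All sums over \<open>X\<close> or \<open>X \<times> X\<close> are
  unconditional; since \<open>infsum\<close> is 0 on divergent sums, summability is required explicitly
  wherever it is not automatic.
\<close>

definition weighted_graph :: "('a \<Rightarrow> 'a \<Rightarrow> real) \<Rightarrow> bool" where
  "weighted_graph b \<longleftrightarrow>
     (\<forall>x y. b x y \<ge> 0) \<and> (\<forall>x. b x x = 0) \<and> (\<forall>x y. b x y = b y x) \<and>
     (\<forall>x. (\<lambda>y. b x y) summable_on UNIV)"

definition connected_graph :: "('a \<Rightarrow> 'a \<Rightarrow> real) \<Rightarrow> bool" where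
  "connected_graph b \<longleftrightarrow> (\<forall>x y. (\<lambda>x y. b x y > 0)\<^sup>*\<^sup>* x y)"

definition ell2 :: "('a \<Rightarrow> real) \<Rightarrow> ('a \<Rightarrow> real) set" where
  "ell2 m = {u. (\<lambda>x. (u x)\<^sup>2 * m x) summable_on UNIV}"

definition l2_inner :: "('a \<Rightarrow> real) \<Rightarrow> ('a \<Rightarrow> real) \<Rightarrow> ('a \<Rightarrow> real) \<Rightarrow> real" where
  "l2_inner m u v = (\<Sum>\<^sub>\<infinity>x. u x * v x * m x)"

definition l2_norm :: "('a \<Rightarrow> real) \<Rightarrow> ('a \<Rightarrow> real) \<Rightarrow> real" where
  "l2_norm m u = sqrt (l2_inner m u u)"

definition fin_supp :: "('a \<Rightarrow> real) set" where
  "fin_supp = {u. finite {x. u x \<noteq> 0}}"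

definition formal_dom :: "('a \<Rightarrow> 'a \<Rightarrow> real) \<Rightarrow> ('a \<Rightarrow> real) set" where
  "formal_dom b = {u. \<forall>x. (\<lambda>y. b x y * \<bar>u y\<bar>) summable_on UNIV}"


text \<open>The first sum is over ordered pairs, without a factor \<open>1/2\<close>. It converges
  for \<open>u\<close> in \<^term>\<open>formal_dom b\<close> and \<open>v\<close> in \<^term>\<open>fin_supp\<close>, and for \<open>u\<close>, \<open>v\<close> both of finite energy.\<close>

definition graph_form ::
  "('a \<Rightarrow> 'a \<Rightarrow> real) \<Rightarrow> ('a \<Rightarrow> real) \<Rightarrow> ('a \<Rightarrow> real) \<Rightarrow> ('a \<Rightarrow> real) \<Rightarrow> real" where
  "graph_form b c u v =
     (\<Sum>\<^sub>\<infinity>(x, y). b x y * (u x - u y) * (v x - v y)) + (\<Sum>\<^sub>\<infinity>x. c x * u x * v x)"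

definition finite_energy :: "('a \<Rightarrow> 'a \<Rightarrow> real) \<Rightarrow> ('a \<Rightarrow> real) \<Rightarrow> ('a \<Rightarrow> real) set" where
  "finite_energy b c =
     {u. (\<lambda>(x, y). b x y * (u x - u y)\<^sup>2) summable_on UNIV \<and>
         (\<lambda>x. c x * (u x)\<^sup>2) summable_on UNIV}"

definition form_norm ::
  "('a \<Rightarrow> real) \<Rightarrow> (('a \<Rightarrow> real) \<Rightarrow> ('a \<Rightarrow> real) \<Rightarrow> real) \<Rightarrow> ('a \<Rightarrow> real) \<Rightarrow> real" where
  "form_norm m E v = sqrt (E v v + (l2_norm m v)\<^sup>2)"

text \<open>The closure of the finitely supported functions is taken inside the square-summable
  functions of finite energy, where the form norm is given by convergent sums.\<close>

definition graph_form_dom ::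
  "('a \<Rightarrow> 'a \<Rightarrow> real) \<Rightarrow> ('a \<Rightarrow> real) \<Rightarrow> ('a \<Rightarrow> real) \<Rightarrow> ('a \<Rightarrow> real) set" where
  "graph_form_dom b c m =
     {u \<in> ell2 m \<inter> finite_energy b c.
        \<exists>v. (\<forall>n::nat. v n \<in> fin_supp) \<and>
            (\<lambda>n. form_norm m (graph_form b c) (\<lambda>x. v n x - u x)) \<longlonglongrightarrow> 0}"


text \<open>A Dirichlet form on \<open>\<ell>\<^sup>2(X,m)\<close> with domain \<open>D\<close>: a densely defined, nonnegative, symmetric,
  bilinear form that is closed and Markovian (the unit contraction operates on it).\<close>

definition dirichlet_form ::
  "('a \<Rightarrow> real) \<Rightarrow> ('a \<Rightarrow> real) set \<Rightarrow> (('a \<Rightarrow> real) \<Rightarrow> ('a \<Rightarrow> real) \<Rightarrow> real) \<Rightarrow> bool" where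
  "dirichlet_form m D E \<longleftrightarrow>
     D \<subseteq> ell2 m \<and>
     (\<lambda>x. 0) \<in> D \<and>
     (\<forall>u\<in>D. \<forall>v\<in>D. (\<lambda>x. u x + v x) \<in> D) \<and>
     (\<forall>a. \<forall>u\<in>D. (\<lambda>x. a * u x) \<in> D) \<and>
     (\<forall>f\<in>ell2 m. \<forall>\<epsilon>>0. \<exists>u\<in>D. l2_norm m (\<lambda>x. f x - u x) < \<epsilon>) \<and>
     (\<forall>u\<in>D. \<forall>v\<in>D. E u v = E v u) \<and>
     (\<forall>u\<in>D. \<forall>v\<in>D. \<forall>w\<in>D. E (\<lambda>x. u x + v x) w = E u w + E v w) \<and>
     (\<forall>a. \<forall>u\<in>D. \<forall>w\<in>D. E (\<lambda>x. a * u x) w = a * E u w) \<and>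
     (\<forall>u\<in>D. E u u \<ge> 0) \<and>
     (\<forall>s. (\<forall>n::nat. s n \<in> D) \<and>
          (\<forall>\<epsilon>>0. \<exists>N. \<forall>j\<ge>N. \<forall>k\<ge>N. form_norm m E (\<lambda>x. s j x - s k x) < \<epsilon>) \<longrightarrow>
          (\<exists>u\<in>D. (\<lambda>n. form_norm m E (\<lambda>x. s n x - u x)) \<longlonglongrightarrow> 0)) \<and>
     (\<forall>u\<in>D. (\<lambda>x. min (max (u x) 0) 1) \<in> D \<and>
             E (\<lambda>x. min (max (u x) 0) 1) (\<lambda>x. min (max (u x) 0) 1) \<le> E u u)"

text \<open>Regularity for the discrete topology on \<open>X\<close>, where the continuous functions of compact
  support are the finitely supported ones.\<close>

definition regular_dirichlet_form ::
  "('a \<Rightarrow> real) \<Rightarrow> ('a \<Rightarrow> real) set \<Rightarrow> (('a \<Rightarrow> real) \<Rightarrow> ('a \<Rightarrow> real) \<Rightarrow> real) \<Rightarrow> bool" where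
  "regular_dirichlet_form m D E \<longleftrightarrow>
     dirichlet_form m D E \<and>
     (\<forall>u\<in>D. \<forall>\<epsilon>>0. \<exists>v\<in>D \<inter> fin_supp. form_norm m E (\<lambda>x. u x - v x) < \<epsilon>) \<and>
     (\<forall>f\<in>fin_supp. \<forall>\<epsilon>>0. \<exists>v\<in>D \<inter> fin_supp. \<forall>x. \<bar>f x - v x\<bar> < \<epsilon>)"

text \<open>The operator associated with a form, as a graph: \<open>(u, f)\<close> stands for \<open>H u = f\<close>.\<close>

definition form_operator ::
  "('a \<Rightarrow> real) \<Rightarrow> ('a \<Rightarrow> real) set \<Rightarrow> (('a \<Rightarrow> real) \<Rightarrow> ('a \<Rightarrow> real) \<Rightarrow> real)
     \<Rightarrow> (('a \<Rightarrow> real) \<times> ('a \<Rightarrow> real)) set" where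
  "form_operator m D E =
     {(u, f). u \<in> D \<and> f \<in> ell2 m \<and> (\<forall>v\<in>D. E u v = l2_inner m f v)}"

text \<open>The spectrum of an operator on \<open>\<ell>\<^sup>2(X,m)\<close> given by its graph \<open>A\<close>: \<open>r\<close> is in the
  resolvent set iff \<open>A - r\<close> is a bijection from its domain onto \<open>\<ell>\<^sup>2(X,m)\<close> with bounded inverse.
  Only real \<open>r\<close> occur: the spectrum of a self-adjoint operator is real, and for real \<open>r\<close>
  invertibility on the real space and on its complexification coincide.\<close>

definition resolvent_set ::
  "('a \<Rightarrow> real) \<Rightarrow> (('a \<Rightarrow> real) \<times> ('a \<Rightarrow> real)) set \<Rightarrow> real set" where
  "resolvent_set m A =
     {r. (\<forall>g\<in>ell2 m. \<exists>!u. \<exists>f. (u, f) \<in> A \<and> g = (\<lambda>x. f x - r * u x)) \<and>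
         (\<exists>C. \<forall>(u, f)\<in>A. l2_norm m u \<le> C * l2_norm m (\<lambda>x. f x - r * u x))}"

definition op_spectrum ::
  "('a \<Rightarrow> real) \<Rightarrow> (('a \<Rightarrow> real) \<times> ('a \<Rightarrow> real)) set \<Rightarrow> real set" where
  "op_spectrum m A = - resolvent_set m A"


definition schroedinger_form ::
  "('a \<Rightarrow> 'a \<Rightarrow> real) \<Rightarrow> ('a \<Rightarrow> real) \<Rightarrow> ('a \<Rightarrow> real) \<Rightarrow> ('a \<Rightarrow> real)
     \<Rightarrow> ('a \<Rightarrow> real) \<Rightarrow> ('a \<Rightarrow> real) \<Rightarrow> real" where
  "schroedinger_form b c m W u v = graph_form b c u v + (\<Sum>\<^sub>\<infinity>x. W x * u x * v x * m x)"

definition nonneg_op ::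
  "('a \<Rightarrow> 'a \<Rightarrow> real) \<Rightarrow> ('a \<Rightarrow> real) \<Rightarrow> ('a \<Rightarrow> real) \<Rightarrow> ('a \<Rightarrow> real) \<Rightarrow> bool" where
  "nonneg_op b c m W \<longleftrightarrow> (\<forall>v\<in>fin_supp. schroedinger_form b c m W v v \<ge> 0)"

definition subcritical ::
  "('a \<Rightarrow> 'a \<Rightarrow> real) \<Rightarrow> ('a \<Rightarrow> real) \<Rightarrow> ('a \<Rightarrow> real) \<Rightarrow> ('a \<Rightarrow> real) \<Rightarrow> bool" where
  "subcritical b c m W \<longleftrightarrow>
     nonneg_op b c m W \<and>
     (\<exists>W'. (\<forall>x. W' x \<ge> 0) \<and> (\<exists>x. W' x \<noteq> 0) \<and>
           (\<forall>v\<in>fin_supp. schroedinger_form b c m W v v - (\<Sum>\<^sub>\<infinity>x. W' x * (v x)\<^sup>2) \<ge> 0))"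

definition critical ::
  "('a \<Rightarrow> 'a \<Rightarrow> real) \<Rightarrow> ('a \<Rightarrow> real) \<Rightarrow> ('a \<Rightarrow> real) \<Rightarrow> ('a \<Rightarrow> real) \<Rightarrow> bool" where
  "critical b c m W \<longleftrightarrow> nonneg_op b c m W \<and> \<not> subcritical b c m W"

text \<open>In the critical case on a connected graph the ground state is unique up to a positive
  constant; the predicate holds for every choice of that constant.\<close>

definition ground_state ::
  "('a \<Rightarrow> 'a \<Rightarrow> real) \<Rightarrow> ('a \<Rightarrow> real) \<Rightarrow> ('a \<Rightarrow> real) \<Rightarrow> ('a \<Rightarrow> real) \<Rightarrow> ('a \<Rightarrow> real) \<Rightarrow> bool" where
  "ground_state b c m W \<phi> \<longleftrightarrow>
     \<phi> \<in> formal_dom b \<and> (\<forall>x. \<phi> x > 0) \<and> (\<forall>v\<in>fin_supp. schroedinger_form b c m W \<phi> v = 0)"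

definition generalized_eigenfunction ::
  "('a \<Rightarrow> 'a \<Rightarrow> real) \<Rightarrow> ('a \<Rightarrow> real) \<Rightarrow> ('a \<Rightarrow> real) \<Rightarrow> real \<Rightarrow> ('a \<Rightarrow> real) \<Rightarrow> bool" where
  "generalized_eigenfunction b c m r u \<longleftrightarrow>
     u \<in> formal_dom b \<and> (\<exists>x. u x \<noteq> 0) \<and>
     (\<forall>v\<in>fin_supp. graph_form b c u v = r * l2_inner m u v)"

end

theory Submission
  imports Defs
begin

text \<open>
  Put \<open>h = u/\<phi>\<close>, so \<open>|h| \<le> 1\<close>, and let \<open>E\<close> be the energy form of the weights \<open>b(x,y) \<phi>(x) \<phi>(y)\<close>.
  Since \<open>\<phi>\<close> is harmonic, \<open>Q\<^bsub>H+W\<^esub>(\<phi> f, \<phi> g) = E(f, g)\<close>. For finitely supported \<open>f\<close> the commutator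
  \<open>(Q - r)(u f, \<phi> g) = E(h f, g) - E(h, f g)\<close> is bounded by a constant times \<open>E(f, f)\<^sup>1\<^sup>/\<^sup>2\<close> and the form
  norm of \<open>\<phi> g\<close>; a Caccioppoli estimate absorbs the gradient of \<open>h\<close>. If \<open>r\<close> were in the
  resolvent set, choosing \<open>\<phi> g\<close> close to \<open>(H - r)\<^sup>-\<^sup>1 (u f)\<close> would give \<open>\<parallel>u f\<parallel>\<^sup>2 \<le> s E(f, f) = s Q\<^bsub>H+W\<^esub>(\<phi> f, \<phi> f)\<close>
  with \<open>s\<close> independent of \<open>f\<close>. This is a Hardy inequality whose weight is positive wherever \<open>u \<noteq> 0\<close>,
  so \<open>H + W\<close> would be subcritical.
\<close>

section \<open>Sums over weighted graphs\<close>

lemma summable_on_comparison_real: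
  fixes f g :: "'b \<Rightarrow> real"
  assumes "g summable_on A" "\<And>x. x \<in> A \<Longrightarrow> \<bar>f x\<bar> \<le> g x"
  shows "f summable_on A"
  by (rule Infinite_Sum.abs_summable_summable, rule Infinite_Sum.abs_summable_on_comparison_test'[OF assms(1)])
    (use assms(2) in auto)

lemma
  fixes f g :: "'b \<Rightarrow> real"
  assumes "f summable_on A" "g summable_on A"
  shows summable_on_minus_real: "(\<lambda>x. f x - g x) summable_on A"
    and infsum_minus_real: "infsum (\<lambda>x. f x - g x) A = infsum f A - infsum g A"
  using summable_on_add[of f A "\<lambda>x. - g x"] infsum_add[of f A "\<lambda>x. - g x"] assms
  by (simp_all add: summable_on_uminus infsum_uminus)

text \<open>\<open>G\<close> lives on finitely many rows and columns, each a summable one-variable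
  sum. The columns run only over \<open>UNIV - S\<close>, which makes them disjoint from the rows,
  so summability on disjoint unions applies.\<close>

lemma summable_on_strips:
  fixes G :: "'a \<times> 'a \<Rightarrow> real"
  assumes "finite S"
    and row: "\<And>x. (\<lambda>y. G (x, y)) summable_on UNIV"
    and col: "\<And>y. (\<lambda>x. G (x, y)) summable_on UNIV"
    and zero: "\<And>x y. x \<notin> S \<Longrightarrow> y \<notin> S \<Longrightarrow> G (x, y) = 0"
  shows "G summable_on UNIV"
proof -
  have "G summable_on (\<Union>x\<in>S. Pair x ` UNIV)"
  proof (rule summable_on_finite_union_disjoint[OF \<open>finite S\<close>])
    show "G summable_on Pair x ` UNIV" for x
      using row[of x] by (simp add: summable_on_reindex inj_on_def o_def)
  qed auto
  moreover have "G summable_on (\<Union>y\<in>S. (\<lambda>x. (x, y)) ` (UNIV - S))"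
  proof (rule summable_on_finite_union_disjoint[OF \<open>finite S\<close>])
    show "G summable_on (\<lambda>x. (x, y)) ` (UNIV - S)" for y
      using summable_on_subset_banach[OF col[of y], of "UNIV - S"]
      by (simp add: summable_on_reindex inj_on_def o_def)
  qed auto
  ultimately have "G summable_on (\<Union>x\<in>S. Pair x ` UNIV) \<union> (\<Union>y\<in>S. (\<lambda>x. (x, y)) ` (UNIV - S))"
    by (rule summable_on_Un_disjoint) auto
  moreover have "G summable_on (\<Union>x\<in>S. Pair x ` UNIV) \<union> (\<Union>y\<in>S. (\<lambda>x. (x, y)) ` (UNIV - S))
      \<longleftrightarrow> G summable_on UNIV"
  proof (rule summable_on_cong_neutral)
    fix p
    assume p: "p \<in> UNIV - ((\<Union>x\<in>S. Pair x ` UNIV) \<union> (\<Union>y\<in>S. (\<lambda>x. (x, y)) ` (UNIV - S)))"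
    obtain x y where xy: "p = (x, y)" by fastforce
    with p have "x \<notin> S" "y \<notin> S" by blast+
    then show "G p = 0" using zero xy by blast
  qed auto
  ultimately show ?thesis by blast
qed

lemma weighted_graphD:
  assumes "weighted_graph b"
  shows "b x y \<ge> 0" "b x y = b y x" "(\<lambda>y. b x y) summable_on UNIV"
  using assms unfolding weighted_graph_def by (blast, metis, blast)

text \<open>Along a row the bound splits into \<open>M * \<bar>u x\<bar> * b x y\<close>, summable
  because \<open>b\<close> is, and \<open>M * (b x y * \<bar>u y\<bar>)\<close>, summable because
  \<open>u\<close> lies in \<open>formal_dom b\<close>. Symmetry of \<open>b\<close> turns columns
  into rows.\<close>

lemma weighted_summable:
  assumes "weighted_graph b" "u \<in> formal_dom b" "finite S"
    and bound: "\<And>x y. \<bar>F x y\<bar> \<le> M * (\<bar>u x\<bar> + \<bar>u y\<bar>)"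
    and zero: "\<And>x y. x \<notin> S \<Longrightarrow> y \<notin> S \<Longrightarrow> F x y = 0"
  shows "(\<lambda>(x, y). b x y * F x y) summable_on UNIV"
proof (rule summable_on_strips[OF \<open>finite S\<close>])
  note b = weighted_graphD[OF assms(1)]
  have dom: "(\<lambda>y. M * \<bar>u x\<bar> * b x y + M * (b x y * \<bar>u y\<bar>)) summable_on UNIV" for x
    using assms(2) b(3) unfolding formal_dom_def
    by (intro summable_on_add summable_on_cmult_right) auto
  have le: "\<bar>b x y * F x y\<bar> \<le> M * \<bar>u x\<bar> * b x y + M * (b x y * \<bar>u y\<bar>)" for x y
    using mult_left_mono[OF bound[of x y] b(1)[of x y]] b(1)[of x y]
    by (simp add: abs_mult algebra_simps)
  show "(\<lambda>y. case (x, y) of (x, y) \<Rightarrow> b x y * F x y) summable_on UNIV" for x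
    using summable_on_comparison_real[OF dom[of x] le] by simp
  have le': "\<bar>b x y * F x y\<bar> \<le> M * \<bar>u y\<bar> * b y x + M * (b y x * \<bar>u x\<bar>)" for x y
    using le[of x y] b(2)[of x y] by (simp add: algebra_simps)
  show "(\<lambda>x. case (x, y) of (x, y) \<Rightarrow> b x y * F x y) summable_on UNIV" for y
    using summable_on_comparison_real[OF dom[of y] le'] by simp
qed (use zero in auto)

section \<open>Finitely supported test functions and the formal domain\<close>

lemma fin_supp_bounded:
  assumes "v \<in> fin_supp"
  obtains M where "M \<ge> 0" "\<And>x. \<bar>v x\<bar> \<le> M"
proof
  let ?M = "\<Sum>x\<in>{x. v x \<noteq> 0}. \<bar>v x\<bar>"
  have fin: "finite {x. v x \<noteq> 0}" using assms by (simp add: fin_supp_def)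
  show "?M \<ge> 0" by (simp add: sum_nonneg)
  show "\<bar>v x\<bar> \<le> ?M" for x
  proof (cases "v x = 0")
    case False
    then show ?thesis
      using member_le_sum[of x "{x. v x \<noteq> 0}" "\<lambda>x. \<bar>v x\<bar>"] fin by simp
  qed (simp add: sum_nonneg)
qed

lemma fin_supp_mono:
  fixes v w :: "'a \<Rightarrow> real"
  assumes "v \<in> fin_supp" "\<And>x. v x = 0 \<Longrightarrow> w x = 0"
  shows "w \<in> fin_supp"
proof -
  have "{x. w x \<noteq> 0} \<subseteq> {x. v x \<noteq> 0}" using assms(2) by blast
  then show ?thesis using assms(1) finite_subset unfolding fin_supp_def by blast
qed

lemma summable_fin_supp: "v \<in> fin_supp \<Longrightarrow> v summable_on UNIV"
  unfolding fin_supp_def by (intro finite_nonzero_values_imp_summable_on) simp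

lemma summable_fin_supp_mono:
  fixes v w :: "'a \<Rightarrow> real"
  assumes "v \<in> fin_supp" "\<And>x. v x = 0 \<Longrightarrow> w x = 0"
  shows "w summable_on UNIV"
  by (rule summable_fin_supp, rule fin_supp_mono[OF assms(1)]) (rule assms(2))

text \<open>A pair contributes only if one of its points lies in the finite support of
  \<open>v\<close>, and the factor \<open>v x - v y\<close> is at most \<open>2 * M\<close> in
  absolute value.\<close>

lemma graph_form_summable:
  assumes "weighted_graph b" "u \<in> formal_dom b" "v \<in> fin_supp"
  shows "(\<lambda>(x, y). b x y * (u x - u y) * (v x - v y)) summable_on UNIV"
proof -
  obtain M where M: "M \<ge> 0" "\<And>x. \<bar>v x\<bar> \<le> M"
    using fin_supp_bounded assms(3) by blast
  have "(\<lambda>(x, y). b x y * ((u x - u y) * (v x - v y))) summable_on UNIV"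
  proof (rule weighted_summable[OF assms(1,2)])
    show "finite {x. v x \<noteq> 0}" using assms(3) by (simp add: fin_supp_def)
    show "\<bar>(u x - u y) * (v x - v y)\<bar> \<le> (2 * M) * (\<bar>u x\<bar> + \<bar>u y\<bar>)" for x y
    proof -
      have "\<bar>v x - v y\<bar> \<le> 2 * M" using M(2)[of x] M(2)[of y] by linarith
      moreover have "\<bar>u x - u y\<bar> \<le> \<bar>u x\<bar> + \<bar>u y\<bar>" by linarith
      ultimately have "\<bar>u x - u y\<bar> * \<bar>v x - v y\<bar> \<le> (\<bar>u x\<bar> + \<bar>u y\<bar>) * (2 * M)"
        by (intro mult_mono) auto
      then show ?thesis by (simp add: abs_mult mult.commute)
    qed
  qed auto
  then show ?thesis by (simp add: mult.assoc)
qed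

text \<open>Applied with \<open>w = 1\<close> to bounded functions, and with
  \<open>w = \<phi>\<close> to products of \<open>\<phi>\<close> with bounded functions.\<close>

lemma formal_dom_le:
  assumes "weighted_graph b" "w \<in> formal_dom b" "\<And>x. \<bar>u x\<bar> \<le> B * \<bar>w x\<bar>"
  shows "u \<in> formal_dom b"
  unfolding formal_dom_def
proof (intro CollectI allI)
  fix x
  have "(\<lambda>y. B * (b x y * \<bar>w y\<bar>)) summable_on UNIV"
    using assms(2) unfolding formal_dom_def by (intro summable_on_cmult_right) auto
  then show "(\<lambda>y. b x y * \<bar>u y\<bar>) summable_on UNIV"
  proof (rule summable_on_comparison_real)
    show "\<bar>b x y * \<bar>u y\<bar>\<bar> \<le> B * (b x y * \<bar>w y\<bar>)" for y
    proof -
      have "b x y * \<bar>u y\<bar> \<le> b x y * (B * \<bar>w y\<bar>)"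
        using weighted_graphD(1)[OF assms(1)] by (intro mult_left_mono assms(3))
      moreover have "\<bar>b x y * \<bar>u y\<bar>\<bar> = b x y * \<bar>u y\<bar>"
        using weighted_graphD(1)[OF assms(1)] by simp
      moreover have "b x y * (B * \<bar>w y\<bar>) = B * (b x y * \<bar>w y\<bar>)" by algebra
      ultimately show ?thesis by linarith
    qed
  qed
qed

section \<open>The ground state transform\<close>

definition transform_weight :: "('a \<Rightarrow> 'a \<Rightarrow> real) \<Rightarrow> ('a \<Rightarrow> real) \<Rightarrow> 'a \<Rightarrow> 'a \<Rightarrow> real" where
  "transform_weight b \<phi> x y = b x y * \<phi> x * \<phi> y"

definition energy :: "('a \<Rightarrow> 'a \<Rightarrow> real) \<Rightarrow> ('a \<Rightarrow> real) \<Rightarrow> ('a \<Rightarrow> real) \<Rightarrow> real" where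
  "energy a u v = (\<Sum>\<^sub>\<infinity>(x, y). a x y * (u x - u y) * (v x - v y))"

text \<open>The row sum at \<open>x\<close> is \<open>\<phi> x\<close> times the sum of
  \<open>b x y * \<phi> y\<close>, which is finite exactly because \<open>\<phi>\<close> is in
  \<open>formal_dom b\<close>.\<close>

lemma weighted_graph_transform:
  assumes "weighted_graph b" "\<phi> \<in> formal_dom b" "\<And>x. \<phi> x > 0"
  shows "weighted_graph (transform_weight b \<phi>)"
proof -
  have "(\<lambda>y. \<phi> x * (b x y * \<bar>\<phi> y\<bar>)) summable_on UNIV" for x
    using assms(2) unfolding formal_dom_def by (intro summable_on_cmult_right) auto
  moreover have "\<phi> x * (b x y * \<bar>\<phi> y\<bar>) = b x y * \<phi> x * \<phi> y" for x y
    using assms(3)[of y] by (simp add: abs_of_pos)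
  ultimately show ?thesis
    using assms(1) assms(3)[THEN less_imp_le] unfolding weighted_graph_def transform_weight_def
    by (auto simp: mult_ac)
qed

text \<open>On each edge the product rule splits the integrand into the transformed energy and the
  form integrand of the pair \<open>\<phi>\<close>, \<open>\<phi> h k\<close>. The latter, together
  with the \<open>c\<close> and \<open>W\<close> terms, adds up to the form at \<open>\<phi>\<close>
  and \<open>\<phi> h k\<close>, which vanishes by harmonicity. Only \<open>k\<close> has finite
  support; for \<open>h\<close> boundedness suffices.\<close>

lemma ground_state_transform:
  assumes "weighted_graph b" "ground_state b c m W \<phi>"
    and h: "\<And>x. \<bar>h x\<bar> \<le> B" and k: "k \<in> fin_supp"
  shows "schroedinger_form b c m W (\<lambda>x. \<phi> x * h x) (\<lambda>x. \<phi> x * k x)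
    = energy (transform_weight b \<phi>) h k"
proof -
  have \<phi>: "\<phi> \<in> formal_dom b" "\<And>x. \<phi> x > 0"
    and harm: "\<And>v. v \<in> fin_supp \<Longrightarrow> schroedinger_form b c m W \<phi> v = 0"
    using assms(2) unfolding ground_state_def by auto
  note a = weighted_graph_transform[OF assms(1) \<phi>]
  let ?hk = "\<lambda>x. \<phi> x * (h x * k x)"
  let ?c = "\<Sum>\<^sub>\<infinity>x. c x * \<phi> x * ?hk x" and ?W = "\<Sum>\<^sub>\<infinity>x. W x * \<phi> x * ?hk x * m x"
  have "(\<lambda>x. \<phi> x * h x) \<in> formal_dom b"
  proof (rule formal_dom_le[OF assms(1) \<phi>(1)])
    show "\<bar>\<phi> x * h x\<bar> \<le> B * \<bar>\<phi> x\<bar>" for x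
      using mult_right_mono[OF h[of x], of "\<phi> x"] \<phi>(2)[of x] by (simp add: abs_mult abs_of_pos mult.commute[of "\<phi> x"])
  qed
  have hdom: "h \<in> formal_dom (transform_weight b \<phi>)"
  proof (rule formal_dom_le[OF a])
    show "(\<lambda>_. 1) \<in> formal_dom (transform_weight b \<phi>)"
      using a by (simp add: formal_dom_def weighted_graphD(3))
  qed (use h in auto)
  have hk: "?hk \<in> fin_supp" using k by (rule fin_supp_mono) auto
  have "(\<Sum>\<^sub>\<infinity>(x, y). b x y * (\<phi> x * h x - \<phi> y * h y) * (\<phi> x * k x - \<phi> y * k y))
    = (\<Sum>\<^sub>\<infinity>p. (case p of (x, y) \<Rightarrow> transform_weight b \<phi> x y * (h x - h y) * (k x - k y))
        + (case p of (x, y) \<Rightarrow> b x y * (\<phi> x - \<phi> y) * (?hk x - ?hk y)))"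
    by (rule infsum_cong) (auto simp: transform_weight_def algebra_simps)
  also have "\<dots> = energy (transform_weight b \<phi>) h k
      + (\<Sum>\<^sub>\<infinity>(x, y). b x y * (\<phi> x - \<phi> y) * (?hk x - ?hk y))"
    unfolding energy_def
    by (rule infsum_add) (use graph_form_summable[OF a hdom k] graph_form_summable[OF assms(1) \<phi>(1) hk] in auto)
  finally have "(\<Sum>\<^sub>\<infinity>(x, y). b x y * (\<phi> x * h x - \<phi> y * h y) * (\<phi> x * k x - \<phi> y * k y))
    = energy (transform_weight b \<phi>) h k
      + (\<Sum>\<^sub>\<infinity>(x, y). b x y * (\<phi> x - \<phi> y) * (?hk x - ?hk y))" .
  moreover have "(\<Sum>\<^sub>\<infinity>x. c x * (\<phi> x * h x) * (\<phi> x * k x)) = ?c"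
    "(\<Sum>\<^sub>\<infinity>x. W x * (\<phi> x * h x) * (\<phi> x * k x) * m x) = ?W"
    by (simp_all add: mult_ac)
  moreover note harm[OF hk]
  ultimately show ?thesis
    unfolding schroedinger_form_def graph_form_def by linarith
qed

text \<open>Testing the equation for \<open>h\<close> with \<open>h g\<^sup>2\<close> (a Caccioppoli estimate) controls
  the part of the commutator in which the gradient falls on \<open>h\<close>.\<close>

lemma commutator_estimate:
  assumes a: "weighted_graph a" and h: "\<And>x. \<bar>h x\<bar> \<le> 1"
    and eq: "\<And>k. k \<in> fin_supp \<Longrightarrow> energy a h k = (\<Sum>\<^sub>\<infinity>x. \<mu> x * h x * k x)"
    and f: "f \<in> fin_supp" and g: "g \<in> fin_supp" and "s > 0"
  shows "2 * (energy a (\<lambda>x. h x * f x) g - (\<Sum>\<^sub>\<infinity>x. \<mu> x * h x * (f x * g x)))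
    \<le> s * energy a f f + (10 * energy a g g + 4 * (\<Sum>\<^sub>\<infinity>x. \<mu> x * (h x)\<^sup>2 * (g x)\<^sup>2)) / s"
proof -
  have one: "(\<lambda>_. 1) \<in> formal_dom a"
    using a by (simp add: formal_dom_def weighted_graphD(3))
  have bdd: "w \<in> formal_dom a" if "\<And>x. \<bar>w x\<bar> \<le> B" for w B
    by (rule formal_dom_le[OF a one]) (use that in auto)
  have fs: "w \<in> formal_dom a" if "w \<in> fin_supp" for w
    using fin_supp_bounded[OF that] bdd by metis
  have hd: "h \<in> formal_dom a" using bdd h by blast
  have fg: "(\<lambda>x. f x * g x) \<in> fin_supp" using f by (rule fin_supp_mono) auto
  have hf: "(\<lambda>x. h x * f x) \<in> fin_supp" using f by (rule fin_supp_mono) auto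
  have hgg: "(\<lambda>x. h x * (g x)\<^sup>2) \<in> fin_supp" using g by (rule fin_supp_mono) auto
  note S = graph_form_summable[OF a]
  let ?e = "\<lambda>u v p. case p of (x, y) \<Rightarrow> a x y * (u x - u y) * (v x - v y)"
  \<comment> \<open>The comparison is made edge by edge and then summed over all ordered
    pairs.\<close>
  have "2 * (energy a (\<lambda>x. h x * f x) g - energy a h (\<lambda>x. f x * g x))
     = (\<Sum>\<^sub>\<infinity>p. 2 * (?e (\<lambda>x. h x * f x) g p - ?e h (\<lambda>x. f x * g x) p))"
    unfolding energy_def infsum_cmult_right'
    by (subst infsum_minus_real[OF S[OF fs[OF hf] g] S[OF hd fg]]) simp
  also have "\<dots> \<le> (\<Sum>\<^sub>\<infinity>p. s * ?e f f p + (10 * ?e g g p + 4 * ?e h (\<lambda>x. h x * (g x)\<^sup>2) p) / s)"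
  proof (rule infsum_mono)
    show "(\<lambda>p. 2 * (?e (\<lambda>x. h x * f x) g p - ?e h (\<lambda>x. f x * g x) p)) summable_on UNIV"
      by (intro summable_on_cmult_right summable_on_minus_real S fs hf g hd fg)
    show "(\<lambda>p. s * ?e f f p + (10 * ?e g g p + 4 * ?e h (\<lambda>x. h x * (g x)\<^sup>2) p) / s) summable_on UNIV"
      unfolding divide_inverse
      by (intro summable_on_add summable_on_cmult_right summable_on_cmult_left S fs f g hd hgg)
    fix p :: "'a \<times> 'a"
    obtain x y where p: "p = (x, y)" by fastforce
    have e: "?e v w p = a x y * ((v x - v y) * (w x - w y))" for v w
      by (simp add: p mult.assoc)
    define F G H where "F = f x - f y" and "G = g x - g y" and "H = h x - h y"
    \<comment> \<open>With averages over the endpoints the Leibniz rule is exact: the difference of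
      a product is average times difference, summed both ways.\<close>
    define A where "A = (h x + h y) / 2"
    define q where "q = (g x + g y) / 2"
    have A: "\<bar>A\<bar> \<le> 1" using h[of x] h[of y] unfolding A_def by (simp add: abs_le_iff)
    \<comment> \<open>The average of \<open>f\<close> cancels, so \<open>f\<close> enters only
      through its difference \<open>F\<close>. This is why the final bound involves just the energy
      of \<open>f\<close>.\<close>
    have comm: "(h x * f x - h y * f y) * G - H * (f x * g x - f y * g y) = F * (A * G - q * H)"
      unfolding F_def G_def H_def A_def q_def by (simp add: field_simps)
    have cacc: "H * (h x * (g x)\<^sup>2 - h y * (g y)\<^sup>2) = (q\<^sup>2 + G\<^sup>2 / 4) * H\<^sup>2 + 2 * (A * q * G * H)"
      unfolding G_def H_def A_def q_def by (simp add: field_simps power2_eq_square)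
    have AG: "(A * G)\<^sup>2 \<le> G\<^sup>2"
    proof -
      have "A\<^sup>2 \<le> 1" using A by (simp add: abs_square_le_1)
      then show ?thesis using mult_right_mono[of "A\<^sup>2" 1 "G\<^sup>2"] by (simp add: power_mult_distrib)
    qed
    \<comment> \<open>Young's inequality, weighted so that the cross term in \<open>cacc\<close>,
      taken twice, costs one copy of \<open>(q * H)^2\<close>; of the two available, one
      remains.\<close>
    have "0 \<le> (q * H + 2 * (A * G))\<^sup>2" by simp
    then have Z: "- 4 * (A * q * G * H) \<le> (q * H)\<^sup>2 + 4 * (A * G)\<^sup>2"
      by (simp add: power2_eq_square algebra_simps)
    have qG: "(q\<^sup>2 + G\<^sup>2 / 4) * H\<^sup>2 = (q * H)\<^sup>2 + (G * H)\<^sup>2 / 4"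
      by (simp add: power2_eq_square algebra_simps)
    \<comment> \<open>The absorption with the products replaced by variables, which makes it linear:
      \<open>X\<close>, \<open>Y\<close>, \<open>z\<close>, \<open>T\<close>, \<open>R\<close> stand
      for \<open>(q * H)^2\<close>, \<open>(G * H)^2\<close>, \<open>A * q * G * H\<close>,
      \<open>(A * G)^2\<close>, \<open>G^2\<close>.\<close>
    have aux: "X \<le> 2 * (X + Y / 4 + 2 * z) + 4 * R" if "- 4 * z \<le> X + 4 * T" "T \<le> R" "0 \<le> Y"
      for X Y z R T :: real
      using that by (simp add: algebra_simps)
    have B: "(q * H)\<^sup>2 \<le> 2 * (H * (h x * (g x)\<^sup>2 - h y * (g y)\<^sup>2)) + 4 * G\<^sup>2"
      unfolding cacc qG by (rule aux[OF Z AG]) simp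
    \<comment> \<open>Gives \<open>(A * G - q * H)^2 \<le> 2 * (A * G)^2 + 2 * (q * H)^2\<close>;
      inserting \<open>AG\<close> and \<open>B\<close> yields the constant 10 = 2 + 2 * 4.\<close>
    have "0 \<le> (A * G + q * H)\<^sup>2" by simp
    then have P: "(A * G - q * H)\<^sup>2 \<le> 10 * G\<^sup>2 + 4 * (H * (h x * (g x)\<^sup>2 - h y * (g y)\<^sup>2))"
      using AG B by (simp add: power2_eq_square algebra_simps)
    have "0 \<le> (s * F - (A * G - q * H))\<^sup>2 / s" using \<open>s > 0\<close> by simp
    also have "\<dots> = s * F\<^sup>2 + (A * G - q * H)\<^sup>2 / s - 2 * (F * (A * G - q * H))"
      using \<open>s > 0\<close> by (simp add: power2_eq_square field_simps)
    finally have "2 * (F * (A * G - q * H))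
        \<le> s * F\<^sup>2 + (10 * G\<^sup>2 + 4 * (H * (h x * (g x)\<^sup>2 - h y * (g y)\<^sup>2))) / s"
      using divide_right_mono[OF P, of s] \<open>s > 0\<close> by linarith
    from mult_left_mono[OF this weighted_graphD(1)[OF a, of x y]]
    have "2 * (a x y * ((h x * f x - h y * f y) * G - H * (f x * g x - f y * g y)))
      \<le> s * (a x y * F\<^sup>2) + (10 * (a x y * G\<^sup>2) + 4 * (a x y * (H * (h x * (g x)\<^sup>2 - h y * (g y)\<^sup>2)))) / s"
      unfolding comm[symmetric] by (simp add: algebra_simps add_divide_distrib)
    then show "2 * (?e (\<lambda>x. h x * f x) g p - ?e h (\<lambda>x. f x * g x) p)
       \<le> s * ?e f f p + (10 * ?e g g p + 4 * ?e h (\<lambda>x. h x * (g x)\<^sup>2) p) / s"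
      unfolding e F_def G_def H_def by (simp add: power2_eq_square right_diff_distrib)
  qed
  also have "\<dots> = s * energy a f f + (10 * energy a g g + 4 * energy a h (\<lambda>x. h x * (g x)\<^sup>2)) / s"
    unfolding divide_inverse energy_def
    by (simp add: infsum_add infsum_cmult_right' infsum_cmult_left' summable_on_add
        summable_on_cmult_right summable_on_cmult_left S fs f g hd hgg)
  \<comment> \<open>The equation for \<open>h\<close> is used twice: with test function
    \<open>f g\<close> in the commutator, and with \<open>h g^2\<close> to replace the Caccioppoli
    term by a potential term.\<close>
  finally show ?thesis
    unfolding eq[OF fg] eq[OF hgg] by (simp add: power2_eq_square mult.assoc)
qed

section \<open>Nonnegative symmetric forms\<close>

text \<open>Serves both the graph form on its domain and the inner product on \<open>ell2 m\<close>,
  so that convergence in form norm can be treated separately in each summand.\<close>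

locale psd_form =
  fixes D :: "('a \<Rightarrow> real) set" and B :: "('a \<Rightarrow> real) \<Rightarrow> ('a \<Rightarrow> real) \<Rightarrow> real"
  assumes add_closed: "u \<in> D \<Longrightarrow> v \<in> D \<Longrightarrow> (\<lambda>x. u x + v x) \<in> D"
    and scale_closed: "u \<in> D \<Longrightarrow> (\<lambda>x. t * u x) \<in> D"
    and sym: "u \<in> D \<Longrightarrow> v \<in> D \<Longrightarrow> B u v = B v u"
    and add_left: "u \<in> D \<Longrightarrow> v \<in> D \<Longrightarrow> w \<in> D \<Longrightarrow> B (\<lambda>x. u x + v x) w = B u w + B v w"
    and scale_left: "u \<in> D \<Longrightarrow> w \<in> D \<Longrightarrow> B (\<lambda>x. t * u x) w = t * B u w"
    and nonneg: "u \<in> D \<Longrightarrow> B u u \<ge> 0"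
begin

lemma quadratic:
  assumes "u \<in> D" "v \<in> D"
  shows "B (\<lambda>x. u x + t * v x) (\<lambda>x. u x + t * v x) = B u u + 2 * t * B u v + t\<^sup>2 * B v v"
proof -
  note D = assms scale_closed[OF assms(2), of t] add_closed[OF assms(1) scale_closed[OF assms(2), of t]]
  have lin: "B (\<lambda>x. u x + t * v x) w = B u w + t * B v w" if "w \<in> D" for w
    using add_left[OF D(1,3) that] scale_left[OF D(2) that] by simp
  show ?thesis
    unfolding lin[OF D(4)] sym[OF D(1,4)] sym[OF D(2,4)] lin[OF D(1)] lin[OF D(2)] sym[OF D(2,1)]
    by (simp add: power2_eq_square algebra_simps)
qed

text \<open>The polynomial in \<open>pos\<close> is nonnegative for all \<open>t\<close>. If
  \<open>B v v = 0\<close> it is affine, hence constant; otherwise it is evaluated at its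
  minimiser.\<close>

lemma cauchy_schwarz:
  assumes "u \<in> D" "v \<in> D"
  shows "(B u v)\<^sup>2 \<le> B u u * B v v"
proof -
  have pos: "0 \<le> B u u + 2 * t * B u v + t\<^sup>2 * B v v" for t
    using nonneg[OF add_closed[OF assms(1) scale_closed[OF assms(2)]]] quadratic[OF assms]
    by metis
  show ?thesis
  proof (cases "B v v = 0")
    case True
    have "B u v = 0"
    proof (rule ccontr)
      assume "B u v \<noteq> 0"
      \<comment> \<open>At this \<open>t\<close> the affine function in \<open>pos\<close> would
        equal -1.\<close>
      then have "2 * (- (B u u + 1) / (2 * B u v)) * B u v = - B u u - 1"
        by (simp add: field_simps)
      then show False using pos[of "- (B u u + 1) / (2 * B u v)"] True by simp
    qed
    then show ?thesis using True by simp
  next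
    case False
    then have "B v v > 0" using nonneg[OF assms(2)] by simp
    then show ?thesis
      using pos[of "- B u v / B v v"] by (simp add: power2_eq_square field_simps)
  qed
qed

lemma diff_closed: "u \<in> D \<Longrightarrow> v \<in> D \<Longrightarrow> (\<lambda>x. u x - v x) \<in> D"
  using add_closed[of u "\<lambda>x. - 1 * v x"] scale_closed[of v "- 1"] by simp

lemma tendsto_inner:
  assumes "\<And>n. v n \<in> D" "u \<in> D" "w \<in> D"
    and "(\<lambda>n. B (\<lambda>x. v n x - u x) (\<lambda>x. v n x - u x)) \<longlonglongrightarrow> 0"
  shows "(\<lambda>n. B (v n) w) \<longlonglongrightarrow> B u w"
proof -
  let ?d = "\<lambda>n x. v n x - u x"
  have d: "?d n \<in> D" for n using diff_closed assms(1,2) by blast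
  have eq: "B (v n) w = B (?d n) w + B u w" for n
    using add_left[OF d assms(2,3), of n] by simp
  have "(\<lambda>n. (B (?d n) w)\<^sup>2) \<longlonglongrightarrow> 0"
  proof (rule tendsto_sandwich[of "\<lambda>_. 0"])
    show "(\<lambda>n. B (?d n) (?d n) * B w w) \<longlonglongrightarrow> 0"
      using tendsto_mult_right[OF assms(4), of "B w w"] by simp
  qed (use cauchy_schwarz[OF d assms(3)] in auto)
  then have "(\<lambda>n. B (?d n) w) \<longlonglongrightarrow> 0" by simp
  then show ?thesis unfolding eq using tendsto_add[OF _ tendsto_const[of "B u w"]] by fastforce
qed

lemma tendsto_square:
  assumes "\<And>n. v n \<in> D" "u \<in> D"
    and "(\<lambda>n. B (\<lambda>x. v n x - u x) (\<lambda>x. v n x - u x)) \<longlonglongrightarrow> 0"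
  shows "(\<lambda>n. B (v n) (v n)) \<longlonglongrightarrow> B u u"
proof -
  have "B (v n) (v n) = B (\<lambda>x. v n x - u x) (\<lambda>x. v n x - u x) + 2 * B (v n) u - B u u" for n
    using quadratic[OF assms(1) assms(2), of n "- 1"] by simp
  then have "(\<lambda>n. B (v n) (v n)) \<longlonglongrightarrow> 0 + 2 * B u u - B u u"
    using tendsto_inner[OF assms(1,2,2,3)] assms(3) by (simp only:) (intro tendsto_intros)
  then show ?thesis by simp
qed

end

section \<open>The inner product and the graph form as nonnegative forms\<close>

lemma ell2_mult_summable:
  assumes "\<forall>x. m x > 0" "u \<in> ell2 m" "v \<in> ell2 m"
  shows "(\<lambda>x. u x * v x * m x) summable_on UNIV"
proof (rule summable_on_comparison_real)
  show "(\<lambda>x. (u x)\<^sup>2 * m x + (v x)\<^sup>2 * m x) summable_on UNIV"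
    using assms(2,3) unfolding ell2_def by (intro summable_on_add) auto
  show "\<bar>u x * v x * m x\<bar> \<le> (u x)\<^sup>2 * m x + (v x)\<^sup>2 * m x" for x
  proof -
    have "2 * (\<bar>u x\<bar> * \<bar>v x\<bar>) \<le> (u x)\<^sup>2 + (v x)\<^sup>2"
      using sum_squares_bound[of "\<bar>u x\<bar>" "\<bar>v x\<bar>"] by simp
    then have "\<bar>u x\<bar> * \<bar>v x\<bar> \<le> (u x)\<^sup>2 + (v x)\<^sup>2"
      using mult_nonneg_nonneg[OF abs_ge_zero[of "u x"] abs_ge_zero[of "v x"]] by linarith
    from mult_right_mono[OF this, of "m x"] show ?thesis
      using assms(1)[rule_format, of x] by (simp add: abs_mult algebra_simps)
  qed
qed

lemma psd_form_l2:
  assumes m: "\<forall>x. m x > 0"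
  shows "psd_form (ell2 m) (l2_inner m)"
proof
  fix u v w :: "'a \<Rightarrow> real" and t
  note S = ell2_mult_summable[OF m]
  show "u \<in> ell2 m \<Longrightarrow> v \<in> ell2 m \<Longrightarrow> (\<lambda>x. u x + v x) \<in> ell2 m"
  proof -
    assume "u \<in> ell2 m" "v \<in> ell2 m"
    then have "(\<lambda>x. (u x * u x * m x + 2 * (u x * v x * m x)) + v x * v x * m x) summable_on UNIV"
      by (intro summable_on_add summable_on_cmult_right S)
    then show ?thesis unfolding ell2_def by (simp add: power2_eq_square algebra_simps)
  qed
  show "u \<in> ell2 m \<Longrightarrow> (\<lambda>x. t * u x) \<in> ell2 m"
    unfolding ell2_def
    using summable_on_cmult_right[of "\<lambda>x. (u x)\<^sup>2 * m x" UNIV "t\<^sup>2"]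
    by (simp add: power_mult_distrib mult.assoc)
  show "l2_inner m u v = l2_inner m v u"
    unfolding l2_inner_def by (simp add: mult_ac)
  show "l2_inner m (\<lambda>x. u x + v x) w = l2_inner m u w + l2_inner m v w"
    if "u \<in> ell2 m" "v \<in> ell2 m" "w \<in> ell2 m"
    unfolding l2_inner_def using S that by (simp add: distrib_right infsum_add)
  show "l2_inner m (\<lambda>x. t * u x) w = t * l2_inner m u w"
    unfolding l2_inner_def by (simp add: mult.assoc infsum_cmult_right')
  show "l2_inner m u u \<ge> 0"
    unfolding l2_inner_def
    by (rule infsum_nonneg) (use m in \<open>simp add: less_imp_le\<close>)
qed

lemma fin_supp_form_dom:
  assumes "weighted_graph b" "v \<in> fin_supp"
  shows "v \<in> graph_form_dom b c m"
proof -
  have one: "(\<lambda>_. 1) \<in> formal_dom b"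
    using assms(1) by (simp add: formal_dom_def weighted_graphD(3))
  obtain M where M: "\<And>x. \<bar>v x\<bar> \<le> M" using fin_supp_bounded assms(2) by blast
  have "v \<in> formal_dom b"
    by (rule formal_dom_le[OF assms(1) one, of _ M]) (use M in auto)
  then have "(\<lambda>(x, y). b x y * (v x - v y)\<^sup>2) summable_on UNIV"
    using graph_form_summable[OF assms(1) _ assms(2)] by (simp add: power2_eq_square mult.assoc)
  moreover have "(\<lambda>x. c x * (v x)\<^sup>2) summable_on UNIV" "(\<lambda>x. (v x)\<^sup>2 * m x) summable_on UNIV"
    by (rule summable_fin_supp_mono[OF assms(2)], simp)+
  moreover have "\<exists>w. (\<forall>n::nat. w n \<in> fin_supp) \<and>
      (\<lambda>n. form_norm m (graph_form b c) (\<lambda>x. w n x - v x)) \<longlonglongrightarrow> 0"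
    using assms(2)
    \<comment> \<open>The constant sequence \<open>v\<close> approximates itself.\<close>
    by (intro exI[of _ "\<lambda>_. v"])
      (simp add: form_norm_def graph_form_def l2_norm_def l2_inner_def split_def cong: infsum_cong)
  ultimately show ?thesis
    unfolding graph_form_dom_def ell2_def finite_energy_def by simp
qed

lemma psd_form_dirichlet:
  assumes "dirichlet_form m D E"
  shows "psd_form D E"
  using assms unfolding dirichlet_form_def by unfold_locales blast+

section \<open>From the commutator bound to the spectrum\<close>

text \<open>\<open>commutator_estimate\<close> for \<open>h = u / \<phi>\<close> and
  \<open>g = v / \<phi>\<close>, carried back through the ground state transform. The hypothesis
  \<open>\<bar>u\<bar> \<le> \<phi>\<close> is what makes \<open>h\<close> bounded by 1.\<close>

lemma commutator_form_bound:
  assumes b: "weighted_graph b" and m: "\<forall>x. m x > 0"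
    and gs: "ground_state b c m W \<phi>" and ef: "generalized_eigenfunction b c m r u"
    and le: "\<forall>x. \<bar>u x\<bar> \<le> \<phi> x" and M: "\<And>x. \<bar>W x\<bar> \<le> M"
    and f: "f \<in> fin_supp" and v: "v \<in> fin_supp" and Q: "graph_form b c v v \<ge> 0" and "s > 0"
  shows "2 * (graph_form b c (\<lambda>x. u x * f x) v - r * l2_inner m (\<lambda>x. u x * f x) v)
    \<le> s * schroedinger_form b c m W (\<lambda>x. \<phi> x * f x) (\<lambda>x. \<phi> x * f x)
      + (10 + 14 * M + 4 * \<bar>r\<bar>) * (graph_form b c v v + l2_inner m v v) / s"
proof -
  have \<phi>: "\<phi> \<in> formal_dom b" and pos: "\<And>x. \<phi> x > 0"
    using gs unfolding ground_state_def by auto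
  have nz: "\<phi> x \<noteq> 0" for x using pos[of x] by simp
  define h g a where "h = (\<lambda>x. u x / \<phi> x)" and "g = (\<lambda>x. v x / \<phi> x)"
    and "a = transform_weight b \<phi>"
  \<comment> \<open>The potential in the equation for \<open>h\<close>: the eigenvalue equation
    contributes \<open>r\<close>, passing to \<open>H + W\<close> adds \<open>W\<close>, and writing
    \<open>u = \<phi> h\<close> with test function \<open>\<phi> k\<close> produces
    \<open>\<phi>^2\<close>.\<close>
  define \<mu> where "\<mu> = (\<lambda>x. (r + W x) * m x * (\<phi> x)\<^sup>2)"
  note S = summable_fin_supp_mono
  have \<phi>h: "\<phi> x * h x = u x" and \<phi>g: "\<phi> x * g x = v x" for x
    unfolding h_def g_def using nz[of x] by simp_all
  have h: "\<bar>h x\<bar> \<le> 1" for x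
    unfolding h_def using le[rule_format, of x] pos[of x] by (simp add: abs_of_pos)
  have a: "weighted_graph a" unfolding a_def by (rule weighted_graph_transform[OF b \<phi> pos])
  have g: "g \<in> fin_supp" using v by (rule fin_supp_mono) (simp add: g_def)
  note T = ground_state_transform[OF b gs, folded a_def]
  have split: "(\<Sum>\<^sub>\<infinity>x. (r + W x) * (y x * z x * m x))
      = r * l2_inner m y z + (\<Sum>\<^sub>\<infinity>x. W x * y x * z x * m x)" if "z \<in> fin_supp" for y z
  proof -
    have "(\<Sum>\<^sub>\<infinity>x. (r + W x) * (y x * z x * m x))
      = (\<Sum>\<^sub>\<infinity>x. r * (y x * z x * m x) + W x * y x * z x * m x)"
      by (simp add: algebra_simps)
    also have "\<dots> = (\<Sum>\<^sub>\<infinity>x. r * (y x * z x * m x)) + (\<Sum>\<^sub>\<infinity>x. W x * y x * z x * m x)"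
      by (intro infsum_add S[OF that]) simp_all
    finally show ?thesis unfolding l2_inner_def infsum_cmult_right' .
  qed
  have eq: "energy a h k = (\<Sum>\<^sub>\<infinity>x. \<mu> x * h x * k x)" if k: "k \<in> fin_supp" for k
  proof -
    have \<phi>k: "(\<lambda>x. \<phi> x * k x) \<in> fin_supp" using k by (rule fin_supp_mono) simp
    have "energy a h k = graph_form b c u (\<lambda>x. \<phi> x * k x) + (\<Sum>\<^sub>\<infinity>x. W x * u x * (\<phi> x * k x) * m x)"
      using T[of h 1 k] h k unfolding schroedinger_form_def \<phi>h by simp
    also have "\<dots> = (\<Sum>\<^sub>\<infinity>x. (r + W x) * (u x * (\<phi> x * k x) * m x))"
      using ef \<phi>k unfolding generalized_eigenfunction_def split[OF \<phi>k] by simp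
    also have "\<dots> = (\<Sum>\<^sub>\<infinity>x. \<mu> x * h x * k x)"
      unfolding \<mu>_def \<phi>h[symmetric] by (simp add: power2_eq_square mult_ac)
    finally show ?thesis .
  qed
  obtain F where F: "\<And>x. \<bar>f x\<bar> \<le> F" using fin_supp_bounded[OF f] by blast
  obtain G where G: "\<And>x. \<bar>g x\<bar> \<le> G" using fin_supp_bounded[OF g] by blast
  have hf: "\<bar>h x * f x\<bar> \<le> 1 * F" for x
    unfolding abs_mult by (rule mult_mono[OF h F]) auto
  have \<phi>hf: "\<phi> x * (h x * f x) = u x * f x" for x
    using \<phi>h[of x] by (simp add: mult.assoc[symmetric])
  have Ehf: "energy a (\<lambda>x. h x * f x) g = graph_form b c (\<lambda>x. u x * f x) v
      + (\<Sum>\<^sub>\<infinity>x. W x * (u x * f x) * v x * m x)"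
    using T[of "\<lambda>x. h x * f x", OF hf g] unfolding schroedinger_form_def \<phi>hf \<phi>g by simp
  have "(\<Sum>\<^sub>\<infinity>x. \<mu> x * h x * (f x * g x)) = (\<Sum>\<^sub>\<infinity>x. (r + W x) * ((u x * f x) * v x * m x))"
    unfolding \<mu>_def \<phi>h[symmetric] \<phi>g[symmetric] by (simp add: power2_eq_square mult_ac)
  then have lhs: "energy a (\<lambda>x. h x * f x) g - (\<Sum>\<^sub>\<infinity>x. \<mu> x * h x * (f x * g x))
      = graph_form b c (\<lambda>x. u x * f x) v - r * l2_inner m (\<lambda>x. u x * f x) v"
    unfolding Ehf split[OF v] by simp
  have vv: "(\<lambda>x. C * (v x * v x * m x)) summable_on UNIV" for C
    by (rule S[OF v]) simp
  have "(\<Sum>\<^sub>\<infinity>x. W x * v x * v x * m x) \<le> (\<Sum>\<^sub>\<infinity>x. M * (v x * v x * m x))"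
  proof (rule infsum_mono[OF S[OF v] vv])
    show "W x * v x * v x * m x \<le> M * (v x * v x * m x)" for x
    proof -
      have "W x \<le> M" using M[of x] by simp
      moreover have "0 \<le> v x * v x * m x" using m[rule_format, of x] by simp
      ultimately have "W x * (v x * v x * m x) \<le> M * (v x * v x * m x)" by (rule mult_right_mono)
      then show ?thesis by (simp add: mult.assoc)
    qed
  qed simp
  then have Egg: "energy a g g \<le> graph_form b c v v + M * l2_inner m v v"
    using T[of g, OF G g] unfolding schroedinger_form_def \<phi>g l2_inner_def infsum_cmult_right' by simp
  have pot: "(\<Sum>\<^sub>\<infinity>x. \<mu> x * (h x)\<^sup>2 * (g x)\<^sup>2) \<le> (\<bar>r\<bar> + M) * l2_inner m v v"
    unfolding l2_inner_def infsum_cmult_right'[symmetric]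
  proof (rule infsum_mono[OF S[OF g] vv])
    fix x
    have "(r + W x) * (h x)\<^sup>2 \<le> \<bar>r + W x\<bar> * (h x)\<^sup>2" by (intro mult_right_mono) auto
    also have "\<dots> \<le> \<bar>r + W x\<bar> * 1"
      using h[of x] by (intro mult_left_mono) (auto simp: abs_square_le_1)
    also have "\<dots> \<le> \<bar>r\<bar> + M" using M[of x] by simp
    finally have "(r + W x) * (h x)\<^sup>2 * (v x * v x * m x) \<le> (\<bar>r\<bar> + M) * (v x * v x * m x)"
      using m[rule_format, of x] by (intro mult_right_mono) auto
    then show "\<mu> x * (h x)\<^sup>2 * (g x)\<^sup>2 \<le> (\<bar>r\<bar> + M) * (v x * v x * m x)"
      unfolding \<mu>_def \<phi>g[symmetric] by (simp add: power2_eq_square mult_ac)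
  qed simp
  have "0 \<le> M" using M[of undefined] by simp
  have l2: "0 \<le> l2_inner m v v"
    unfolding l2_inner_def by (rule infsum_nonneg) (use m in \<open>simp add: less_imp_le\<close>)
  \<comment> \<open>The coefficient 14 is 10 from \<open>Egg\<close> plus 4 from
    \<open>pot\<close>.\<close>
  have "10 * energy a g g + 4 * (\<Sum>\<^sub>\<infinity>x. \<mu> x * (h x)\<^sup>2 * (g x)\<^sup>2)
      \<le> 10 * graph_form b c v v + (14 * M + 4 * \<bar>r\<bar>) * l2_inner m v v"
    using Egg pot by (simp add: algebra_simps)
  also have "\<dots> \<le> (10 + 14 * M + 4 * \<bar>r\<bar>) * (graph_form b c v v + l2_inner m v v)"
    using l2 mult_nonneg_nonneg[of "14 * M + 4 * \<bar>r\<bar>" "graph_form b c v v"] Q \<open>0 \<le> M\<close>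
    by (simp add: algebra_simps)
  finally have "(10 * energy a g g + 4 * (\<Sum>\<^sub>\<infinity>x. \<mu> x * (h x)\<^sup>2 * (g x)\<^sup>2)) / s
      \<le> (10 + 14 * M + 4 * \<bar>r\<bar>) * (graph_form b c v v + l2_inner m v v) / s"
    using \<open>s > 0\<close> by (intro divide_right_mono) auto
  with commutator_estimate[OF a h eq f g \<open>s > 0\<close>] show ?thesis
    unfolding lhs T[of f, OF F f] by linarith
qed

text \<open>The squared form norm is a sum of two nonnegative terms, so both tend to 0 and
  Cauchy-Schwarz gives continuity of each form. This extends \<open>commutator_form_bound\<close>
  from finitely supported \<open>v\<close> to resolvent images.\<close>

lemma graph_form_dom_approx:
  assumes m: "\<forall>x. m x > 0" and b: "weighted_graph b"
    and psd: "psd_form (graph_form_dom b c m) (graph_form b c)" and u: "u \<in> graph_form_dom b c m"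
  shows "\<exists>v. (\<forall>n::nat. v n \<in> fin_supp) \<and>
    (\<forall>w\<in>graph_form_dom b c m. (\<lambda>n. graph_form b c w (v n)) \<longlonglongrightarrow> graph_form b c w u) \<and>
    (\<forall>w\<in>graph_form_dom b c m. (\<lambda>n. l2_inner m w (v n)) \<longlonglongrightarrow> l2_inner m w u) \<and>
    (\<lambda>n. graph_form b c (v n) (v n)) \<longlonglongrightarrow> graph_form b c u u \<and>
    (\<lambda>n. l2_inner m (v n) (v n)) \<longlonglongrightarrow> l2_inner m u u"
proof -
  let ?D = "graph_form_dom b c m" and ?Q = "graph_form b c" and ?L = "l2_inner m"
  have sub: "?D \<subseteq> ell2 m" unfolding graph_form_dom_def by blast
  interpret Q: psd_form ?D ?Q by (rule psd)
  interpret L: psd_form "ell2 m" ?L by (rule psd_form_l2[OF m])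
  obtain v where v: "\<And>n::nat. v n \<in> fin_supp"
    and lim: "(\<lambda>n. form_norm m ?Q (\<lambda>x. v n x - u x)) \<longlonglongrightarrow> 0"
    using u unfolding graph_form_dom_def by blast
  have vD: "v n \<in> ?D" for n using fin_supp_form_dom[OF b v] .
  let ?d = "\<lambda>n x. v n x - u x"
  have d: "?d n \<in> ?D" for n using Q.diff_closed[OF vD u] .
  have L0: "0 \<le> ?L (?d n) (?d n)" for n using L.nonneg d sub by blast
  have "(form_norm m ?Q (?d n))\<^sup>2 = ?Q (?d n) (?d n) + ?L (?d n) (?d n)" for n
    using Q.nonneg[OF d] L0[of n] unfolding form_norm_def l2_norm_def by simp
  then have sum: "(\<lambda>n. ?Q (?d n) (?d n) + ?L (?d n) (?d n)) \<longlonglongrightarrow> 0"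
    using tendsto_power[OF lim, of 2] by simp
  have Q: "(\<lambda>n. ?Q (?d n) (?d n)) \<longlonglongrightarrow> 0"
    by (rule tendsto_sandwich[OF _ _ tendsto_const sum]) (use Q.nonneg[OF d] L0 in auto)
  have L: "(\<lambda>n. ?L (?d n) (?d n)) \<longlonglongrightarrow> 0"
    by (rule tendsto_sandwich[OF _ _ tendsto_const sum]) (use Q.nonneg[OF d] L0 in auto)
  have vL: "v n \<in> ell2 m" for n using vD sub by blast
  have uL: "u \<in> ell2 m" using u sub by blast
  show ?thesis
  proof (intro exI[of _ v] conjI allI ballI v)
    fix w assume w: "w \<in> ?D"
    then have wL: "w \<in> ell2 m" using sub by blast
    show "(\<lambda>n. ?Q w (v n)) \<longlonglongrightarrow> ?Q w u"
      using Q.tendsto_inner[OF vD u w Q] unfolding Q.sym[OF vD w] Q.sym[OF u w] .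
    show "(\<lambda>n. ?L w (v n)) \<longlonglongrightarrow> ?L w u"
      using L.tendsto_inner[OF vL uL wL L] unfolding L.sym[OF vL wL] L.sym[OF uL wL] .
  next
    show "(\<lambda>n. ?Q (v n) (v n)) \<longlonglongrightarrow> ?Q u u" by (rule Q.tendsto_square[OF vD u Q])
    show "(\<lambda>n. ?L (v n) (v n)) \<longlonglongrightarrow> ?L u u" by (rule L.tendsto_square[OF vL uL L])
  qed
qed

theorem theorem6p3:
  fixes b :: "'a \<Rightarrow> 'a \<Rightarrow> real" and c m W \<phi> u :: "'a \<Rightarrow> real" and r :: real
  assumes "countable (UNIV :: 'a set)" and "infinite (UNIV :: 'a set)"
    and "\<forall>x. m x > 0"
    and "weighted_graph b" and "connected_graph b"
    and "regular_dirichlet_form m (graph_form_dom b c m) (graph_form b c)"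
    and "bounded (range W)"
    and "critical b c m W" and "ground_state b c m W \<phi>"
    and "generalized_eigenfunction b c m r u"
    and "\<forall>x. \<bar>u x\<bar> \<le> \<phi> x"
  shows "r \<in> op_spectrum m (form_operator m (graph_form_dom b c m) (graph_form b c))"
proof (rule ccontr)
  let ?D = "graph_form_dom b c m" and ?Q = "graph_form b c" and ?L = "l2_inner m"
  let ?A = "form_operator m ?D ?Q"
  note m = assms(3) and b = assms(4)
  assume "r \<notin> op_spectrum m ?A"
  then have res: "r \<in> resolvent_set m ?A" by (simp add: op_spectrum_def)
  have sub: "?D \<subseteq> ell2 m" unfolding graph_form_dom_def by blast
  have psd: "psd_form ?D ?Q"
    using assms(6) psd_form_dirichlet unfolding regular_dirichlet_form_def by blast
  interpret Q: psd_form ?D ?Q by (rule psd)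
  interpret L: psd_form "ell2 m" ?L by (rule psd_form_l2[OF m])
  obtain C0 where "\<forall>(v, f)\<in>?A. l2_norm m v \<le> C0 * l2_norm m (\<lambda>x. f x - r * v x)"
    using res unfolding resolvent_set_def by blast
  then have C0: "l2_norm m v \<le> C0 * l2_norm m (\<lambda>x. f x - r * v x)" if "(v, f) \<in> ?A" for v f
    using that by blast
  \<comment> \<open>The resolvent bound comes without a sign for \<open>C0\<close>; monotonicity
    arguments below need a nonnegative constant.\<close>
  define C where "C = \<bar>C0\<bar>"
  have C: "l2_norm m v \<le> C * l2_norm m w"
    if "(v, f) \<in> ?A" "w = (\<lambda>x. f x - r * v x)" "w \<in> ell2 m" for v f w
  proof -
    have "0 \<le> l2_norm m w" using L.nonneg[OF that(3)] by (simp add: l2_norm_def)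
    then have "C0 * l2_norm m w \<le> C * l2_norm m w" unfolding C_def by (intro mult_right_mono) auto
    then show ?thesis using C0[OF that(1)] that(2) by simp
  qed
  obtain M where M: "\<And>x. \<bar>W x\<bar> \<le> M" using assms(7) unfolding bounded_iff by auto
  define K where "K = 10 + 14 * M + 4 * \<bar>r\<bar>"
  \<comment> \<open>Chosen so that the form norm term divided by \<open>s\<close> is at most the
    squared norm of \<open>u f\<close>, half of the left side of \<open>ineq\<close>. The summand 1
    ensures positivity.\<close>
  define s where "s = K * (C + (\<bar>r\<bar> + 1) * C\<^sup>2) + 1"
  have K: "K \<ge> 0" using M[of undefined] unfolding K_def by simp
  have s: "s > 0" using K unfolding s_def C_def by (simp add: add_nonneg_pos)
  have bound: "?L (\<lambda>x. u x * f x) (\<lambda>x. u x * f x)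
      \<le> s * schroedinger_form b c m W (\<lambda>x. \<phi> x * f x) (\<lambda>x. \<phi> x * f x)" if f: "f \<in> fin_supp" for f
  proof -
    let ?w = "\<lambda>x. u x * f x" and ?E = "schroedinger_form b c m W (\<lambda>x. \<phi> x * f x) (\<lambda>x. \<phi> x * f x)"
    have w: "?w \<in> fin_supp" using f by (rule fin_supp_mono) simp
    have wD: "?w \<in> ?D" by (rule fin_supp_form_dom[OF b w])
    then have wL: "?w \<in> ell2 m" using sub by blast
    \<comment> \<open>Here \<open>v\<close> is the resolvent applied to \<open>u f\<close>, and
      \<open>F = H v\<close>.\<close>
    obtain v F where vF: "(v, F) \<in> ?A" and weq: "?w = (\<lambda>x. F x - r * v x)"
      using res wL unfolding resolvent_set_def by blast
    have vD: "v \<in> ?D" and FL: "F \<in> ell2 m" and op: "\<And>z. z \<in> ?D \<Longrightarrow> ?Q v z = ?L F z"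
      using vF unfolding form_operator_def by auto
    have vL: "v \<in> ell2 m" using vD sub by blast
    have Lw: "?L ?w z = ?L F z - r * ?L v z" if "z \<in> ell2 m" for z
      using L.add_left[OF FL L.scale_closed[OF vL, of "- r"] that] L.scale_left[OF vL that, of "- r"]
      unfolding weq by simp
    \<comment> \<open>Tested against this \<open>v\<close>, the commutator expression becomes the
      squared norm of \<open>u f\<close>.\<close>
    have ww: "?L ?w ?w = ?Q ?w v - r * ?L ?w v"
      using Lw[OF wL] op[OF wD] Q.sym[OF vD wD] L.sym[OF vL wL] by simp
    obtain vn where vn: "\<forall>n::nat. vn n \<in> fin_supp"
      "\<forall>z\<in>?D. (\<lambda>n. ?Q z (vn n)) \<longlonglongrightarrow> ?Q z v" "\<forall>z\<in>?D. (\<lambda>n. ?L z (vn n)) \<longlonglongrightarrow> ?L z v"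
      "(\<lambda>n. ?Q (vn n) (vn n)) \<longlonglongrightarrow> ?Q v v" "(\<lambda>n. ?L (vn n) (vn n)) \<longlonglongrightarrow> ?L v v"
      using graph_form_dom_approx[OF m b psd vD] by blast
    note fs = vn(1)[rule_format]
    have le: "2 * (?Q ?w (vn n) - r * ?L ?w (vn n))
        \<le> s * ?E + K * (?Q (vn n) (vn n) + ?L (vn n) (vn n)) / s" for n
      unfolding K_def
      by (rule commutator_form_bound[OF b m assms(9-11) M f fs Q.nonneg[OF fin_supp_form_dom[OF b fs]] s])
    have "2 * (?Q ?w v - r * ?L ?w v) \<le> s * ?E + K * (?Q v v + ?L v v) / s"
    proof (rule LIMSEQ_le)
      show "(\<lambda>n. 2 * (?Q ?w (vn n) - r * ?L ?w (vn n))) \<longlonglongrightarrow> 2 * (?Q ?w v - r * ?L ?w v)"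
        by (intro tendsto_intros vn(2,3)[rule_format] wD)
      show "(\<lambda>n. s * ?E + K * (?Q (vn n) (vn n) + ?L (vn n) (vn n)) / s)
          \<longlonglongrightarrow> s * ?E + K * (?Q v v + ?L v v) / s"
        using s by (intro tendsto_intros vn(4,5)) simp
    qed (use le in blast)
    then have ineq: "2 * ?L ?w ?w \<le> s * ?E + K * (?Q v v + ?L v v) / s" using ww by simp
    define t p where "t = l2_norm m ?w" and "p = l2_norm m v"
    have tp: "t \<ge> 0" "p \<ge> 0" "t\<^sup>2 = ?L ?w ?w" "p\<^sup>2 = ?L v v" "p \<le> C * t"
      using L.nonneg[OF wL] L.nonneg[OF vL] C[OF vF weq wL]
      unfolding t_def p_def l2_norm_def by simp_all
    have "(?L ?w v)\<^sup>2 \<le> (t * p)\<^sup>2"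
      using L.cauchy_schwarz[OF wL vL] tp by (simp add: power_mult_distrib)
    then have "?L ?w v \<le> t * p" using tp by (simp add: power2_le_iff_abs_le)
    also have "t * p \<le> t * (C * t)" using tp by (intro mult_left_mono) auto
    finally have wv: "?L ?w v \<le> C * t\<^sup>2" by (simp add: power2_eq_square mult_ac)
    have p2: "p\<^sup>2 \<le> C\<^sup>2 * t\<^sup>2"
      using power_mono[OF tp(5) tp(2), of 2] by (simp add: power_mult_distrib)
    \<comment> \<open>By \<open>(H - r) v = u f\<close>, the form norm of \<open>v\<close> reduces
      to inner products, which the resolvent bound controls by \<open>t^2\<close>.\<close>
    have "?Q v v + ?L v v = ?L ?w v + (r + 1) * ?L v v"
      using Lw[OF vL] op[OF vD] by (simp add: algebra_simps)
    also have "\<dots> \<le> C * t\<^sup>2 + (\<bar>r\<bar> + 1) * (C\<^sup>2 * t\<^sup>2)"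
      using wv p2 tp(4) L.nonneg[OF vL] by (intro add_mono mult_mono) auto
    also have "\<dots> = (C + (\<bar>r\<bar> + 1) * C\<^sup>2) * t\<^sup>2" by (simp add: algebra_simps)
    finally have "K * (?Q v v + ?L v v) \<le> K * ((C + (\<bar>r\<bar> + 1) * C\<^sup>2) * t\<^sup>2)"
      using K by (rule mult_left_mono)
    also have "\<dots> \<le> s * t\<^sup>2" unfolding s_def by (simp add: algebra_simps)
    finally have "K * (?Q v v + ?L v v) / s \<le> t\<^sup>2" using s by (simp add: field_simps)
    then show ?thesis using ineq tp(3) by simp
  qed
  obtain x0 where x0: "u x0 \<noteq> 0" using assms(10) unfolding generalized_eigenfunction_def by blast
  have pos: "\<And>x. \<phi> x > 0" using assms(9) unfolding ground_state_def by blast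
  \<comment> \<open>The value at \<open>x0\<close> of the Hardy weight from \<open>bound\<close>,
    read off by substituting \<open>f = v / \<phi>\<close>. A weight at this single point already
    contradicts criticality.\<close>
  define \<epsilon> where "\<epsilon> = (u x0)\<^sup>2 * m x0 / (s * (\<phi> x0)\<^sup>2)"
  have \<epsilon>: "\<epsilon> > 0" unfolding \<epsilon>_def using x0 s m pos[of x0] by simp
  define W' where "W' = (\<lambda>x. if x = x0 then \<epsilon> else 0)"
  have "schroedinger_form b c m W v v - (\<Sum>\<^sub>\<infinity>x. W' x * (v x)\<^sup>2) \<ge> 0" if v: "v \<in> fin_supp" for v
  proof -
    define f where "f = (\<lambda>x. v x / \<phi> x)"
    have f: "f \<in> fin_supp" using v by (rule fin_supp_mono) (simp add: f_def)
    have \<phi>f: "\<phi> x * f x = v x" for x using pos[of x] by (simp add: f_def)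
    have "(\<Sum>\<^sub>\<infinity>x. W' x * (v x)\<^sup>2) = (\<Sum>\<^sub>\<infinity>x\<in>{x0}. W' x * (v x)\<^sup>2)"
      by (rule infsum_cong_neutral) (auto simp: W'_def)
    then have "(\<Sum>\<^sub>\<infinity>x. W' x * (v x)\<^sup>2) = \<epsilon> * (v x0)\<^sup>2" by (simp add: W'_def)
    also have "\<dots> = (\<Sum>\<^sub>\<infinity>x\<in>{x0}. u x * f x * (u x * f x) * m x) / s"
      unfolding \<epsilon>_def f_def using pos[of x0] by (simp add: power2_eq_square field_simps)
    \<comment> \<open>All other terms of the squared norm are nonnegative and are dropped.\<close>
    also have "(\<Sum>\<^sub>\<infinity>x\<in>{x0}. u x * f x * (u x * f x) * m x) \<le> ?L (\<lambda>x. u x * f x) (\<lambda>x. u x * f x)"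
      unfolding l2_inner_def
    proof (rule infsum_mono_neutral)
      show "(\<lambda>x. u x * f x * (u x * f x) * m x) summable_on UNIV"
        by (rule summable_fin_supp_mono[OF f]) simp
    qed (use m in \<open>auto simp: less_imp_le\<close>)
    also have "\<dots> \<le> s * schroedinger_form b c m W v v"
      using bound[OF f] unfolding \<phi>f .
    finally show ?thesis using s by (simp add: divide_right_mono)
  qed
  then have "subcritical b c m W"
    using assms(8) \<epsilon> unfolding subcritical_def critical_def
    by (intro conjI exI[of _ W']) (auto simp: W'_def)
  then show False using assms(8) unfolding critical_def by blast
qed

end
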